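(* Let $r\ge 2$ and $\ell\ge 2$ be integers. Then there exists a positive integer $k$ such that $\ell^m+k$ is not $r$-full for every positive integer $m$.
   Context: A positive integer $n$ is called $r$-full if for every prime $p$, $p\mid n$ implies $p^r\mid n$. *)

theory Defs
  imports "HOL-Number_Theory.Number_Theory"
begin

definition r_full :: "nat \<Rightarrow> nat \<Rightarrow> bool" where
  "r_full r n \<longleftrightarrow> n > 0 \<and> (\<forall>p. prime p \<longrightarrow> p dvd n \<longrightarrow> p ^ r dvd n)"

end

theory Submission
  imports Defs
begin

text \<open>
  Let \<open>p\<close> be a prime factor of \<open>l\<close>. If \<open>p\<close> divides \<open>k\<close> exactly once, then it divides
  \<open>l ^ m + k\<close> exactly once as soon as \<open>p\<^sup>2\<close> divides \<open>l ^ m\<close>, in particular for all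
  \<open>m \<ge> 2\<close>. If \<open>p\<^sup>2\<close> divides \<open>l\<close>, take \<open>k = p\<close>. Otherwise take \<open>k = p\<^sup>2 * q - l\<close> with a
  prime \<open>q > l\<close>: then \<open>p\<close> divides \<open>k\<close> exactly once, and \<open>l + k = p\<^sup>2 * q\<close> is divisible
  by \<open>q\<close> exactly once.
\<close>

text \<open>As \<open>r \<ge> 2\<close>, \<open>p ^ r dvd n\<close> would give
  \<open>p\<^sup>2 dvd n\<close>.\<close>

lemma not_r_full_if_prime_exactly_once:
  assumes "r \<ge> 2" "prime p" "p dvd n" "\<not> p\<^sup>2 dvd n"
  shows "\<not> r_full r n"
  using assms by (meson r_full_def dvd_trans le_imp_power_dvd)

lemma not_r_full_add_if_prime_exactly_once:
  assumes "r \<ge> 2" "prime p" "p\<^sup>2 dvd a" "p dvd k" "\<not> p\<^sup>2 dvd k"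
  shows "\<not> r_full r (a + k)"
proof (rule not_r_full_if_prime_exactly_once)
  have "p dvd a"
    using assms(3) by (meson dvd_trans dvd_power pos2)
  then show "p dvd a + k"
    using assms(4) by simp
  show "\<not> p\<^sup>2 dvd a + k"
    using assms(3,5) by (simp add: dvd_add_right_iff)
qed (use assms in auto)

theorem theorem1p1:
  fixes r l :: nat
  assumes "r \<ge> 2" and "l \<ge> 2"
  shows "\<exists>k::nat. k > 0 \<and> (\<forall>m::nat. m > 0 \<longrightarrow> \<not> r_full r (l ^ m + k))"
proof -
  obtain p where p: "prime p" "p dvd l"
    using assms(2) prime_factor_nat[of l] by auto
  show ?thesis
  proof (cases "p\<^sup>2 dvd l")
    case True
    have "\<not> p\<^sup>2 dvd p"
      using prime_gt_1_nat[OF p(1)] by (auto dest!: dvd_imp_le simp: power2_eq_square)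
    moreover have "p\<^sup>2 dvd l ^ m" if "m > 0" for m
      using True that by (meson dvd_power dvd_trans)
    ultimately have "\<not> r_full r (l ^ m + p)" if "m > 0" for m
      using not_r_full_add_if_prime_exactly_once[OF assms(1) p(1)] that by simp
    then show ?thesis
      using prime_gt_0_nat[OF p(1)] by blast
  next
    case False
    \<comment> \<open>The bound \<open>q > l\<close> serves twice: it keeps the natural subtraction
      in \<open>k\<close> from truncating, with \<open>k > 0\<close>, and together with
      \<open>p \<le> l\<close> it forces \<open>q \<noteq> p\<close>.\<close>
    obtain q where q: "prime q" "q > l"
      using bigger_prime by blast
    have "p \<le> l"
      using p(2) assms(2) by (intro dvd_imp_le) auto
    have "q \<le> p\<^sup>2 * q"
      using prime_gt_0_nat[OF p(1)] by simp
    then have less: "l < p\<^sup>2 * q"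
      using q(2) by linarith
    define k where "k = p\<^sup>2 * q - l"
    have sum: "l + k = p\<^sup>2 * q"
      using less by (simp add: k_def)
    have "p dvd l + k"
      unfolding sum by (simp add: power2_eq_square)
    then have pk: "p dvd k"
      using p(2) by (simp add: dvd_add_right_iff)
    \<comment> \<open>\<open>p\<^sup>2\<close> divides \<open>l + k\<close> but not
      \<open>l\<close>, so it cannot divide \<open>k\<close>.\<close>
    have ppk: "\<not> p\<^sup>2 dvd k"
      using False sum by (metis dvd_add_left_iff dvd_triv_left)
    have "\<not> r_full r (l ^ m + k)" if "m > 0" for m
    proof (cases "m = 1")
      case True
      have "\<not> q dvd p\<^sup>2"
        using p(1) q \<open>p \<le> l\<close> by (metis prime_dvd_power primes_dvd_imp_eq not_le)
      then have "\<not> q\<^sup>2 dvd l + k"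
        using prime_gt_0_nat[OF q(1)] by (simp add: sum power2_eq_square)
      then show ?thesis
        using not_r_full_if_prime_exactly_once[OF assms(1) q(1)] True by (simp add: sum)
    next
      case False
      \<comment> \<open>Now \<open>m \<ge> 2\<close>, so \<open>p dvd l\<close> suffices.\<close>
      then have "p\<^sup>2 dvd l ^ m"
        using p(2) that by (intro dvd_power_le) auto
      then show ?thesis
        using not_r_full_add_if_prime_exactly_once[OF assms(1) p(1)] pk ppk by blast
    qed
    moreover have "k > 0"
      using less by (simp add: k_def)
    ultimately show ?thesis
      by blast
  qed
qed

end
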